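(* Let $(\phi(\tau),\ \tau\in\mathcal{T}_0^p)$ be an admissible family. Then the value family $(V_p(S),\ S\in\mathcal{T}_0^p)$ and the strict value family $(V_p^+(S),\ S\in\mathcal{T}_0^p)$ defined by $$V_p(S):=\operatorname*{ess\,sup}_{\tau\in\mathcal{T}_S^p}E[\phi(\tau)|\mathcal{F}_{S^-}],\qquad V_p^+(S):=\operatorname*{ess\,sup}_{\tau\in\mathcal{T}_{S^+}^p}E[\phi(\tau)|\mathcal{F}_{S^-}]$$ are admissible families.
   Context: Fix $T\in(0,\infty)$ and a filtered probability space $(\Omega,\mathbb{F}=(\mathcal{F}_t)_{t\in[0,T]},P)$ whose filtration satisfies the usual conditions (right-continuity and completeness) and is not quasi-left-continuous; $\mathcal{F}_0$ contains only sets of probability $0$ or $1$. For a stopping time $S$, $\mathcal{F}_{S^-}$ is the usual $\sigma$-field of events strictly before $S$ (with $\mathcal{F}_{0^-}=\mathcal{F}_0$). $\mathcal{T}_0^p$ is the set of predictable stopping times with values in $[0,T]$. For $S\in\mathcal{T}_0^p$, $\mathcal{T}_S^p$ is the set of $\tau\in\mathcal{T}_0^p$ with $\tau\ge S$ a.s., and $\mathcal{T}_{S^+}^p$ is the set of $\tau\in\mathcal{T}_0^p$ with $\tau>S$ a.s. on $\{S<T\}$ and $\tau=T$ a.s. on $\{S=T\}$. An admissible family is a family $(\phi(\tau),\ \tau\in\mathcal{T}_0^p)$ such that (1) each $\phi(\tau)$ is an $\mathcal{F}_{\tau^-}$-measurable $[0,\infty]$-valued random variable; (2) for all $\tau,\tau'\in\mathcal{T}_0^p$,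 $\phi(\tau)=\phi(\tau')$ a.s. on $\{\tau=\tau'\}$. *)

theory Defs
  imports "HOL-Probability.Probability"
begin

text \<open>
  The time interval is \<open>[0,T]\<close>, a subset of the reals. The library locale \<^locale>\<open>filtration\<close> has
  the whole index type as time set, so \<open>F\<close> is indexed by all reals; a filtration on \<open>[0,T]\<close>
  extends to one by \<open>F 0\<close> to the left and \<open>F T\<close> to the right. Everything below depends only on the
  restriction of \<open>F\<close> to \<open>[0,T]\<close>: for \<open>\<tau>\<close> with values in \<open>[0,T]\<close> the event \<open>\<tau> \<le> t\<close> is empty for
  \<open>t < 0\<close> and equal to \<open>\<Omega>\<close> for \<open>t \<ge> T\<close>, so \<^const>\<open>stopping_time\<close> has its usual meaning.
\<close>

text \<open>
  The predictable \<open>\<sigma>\<close>-field on \<open>\<Omega> \<times> [0,T]\<close>. The rectangles at time 0 are the convention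
  that the \<open>\<sigma>\<close>-field strictly before 0 is \<open>F 0\<close>.
\<close>

definition predictable_sigma :: "'a measure \<Rightarrow> (real \<Rightarrow> 'a measure) \<Rightarrow> real \<Rightarrow> ('a \<times> real) measure"
where
  "predictable_sigma M F T = sigma (space M \<times> {0..T})
     ({A \<times> {0} | A. A \<in> sets (F 0)} \<union>
      {A \<times> {s<..t} | A s t. 0 \<le> s \<and> s < t \<and> t \<le> T \<and> A \<in> sets (F s)})"

text \<open>
  \<open>\<T>\<^sub>0\<^sup>p\<close>: a stopping time is predictable if its stochastic interval \<open>[\<tau>,T]\<close> is a
  predictable set.
\<close>

definition pred_times :: "'a measure \<Rightarrow> (real \<Rightarrow> 'a measure) \<Rightarrow> real \<Rightarrow> ('a \<Rightarrow> real) set"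
where
  "pred_times M F T = {\<tau>. stopping_time F \<tau> \<and> (\<forall>\<omega>\<in>space M. \<tau> \<omega> \<in> {0..T}) \<and>
     {(\<omega>, t). \<omega> \<in> space M \<and> t \<in> {0..T} \<and> \<tau> \<omega> \<le> t} \<in> sets (predictable_sigma M F T)}"

definition pred_times_from ::
  "'a measure \<Rightarrow> (real \<Rightarrow> 'a measure) \<Rightarrow> real \<Rightarrow> ('a \<Rightarrow> real) \<Rightarrow> ('a \<Rightarrow> real) set"
where
  "pred_times_from M F T S = {\<tau> \<in> pred_times M F T. AE \<omega> in M. S \<omega> \<le> \<tau> \<omega>}"

definition pred_times_after ::
  "'a measure \<Rightarrow> (real \<Rightarrow> 'a measure) \<Rightarrow> real \<Rightarrow> ('a \<Rightarrow> real) \<Rightarrow> ('a \<Rightarrow> real) set"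
where
  "pred_times_after M F T S = {\<tau> \<in> pred_times M F T.
     (AE \<omega> in M. S \<omega> < T \<longrightarrow> S \<omega> < \<tau> \<omega>) \<and> (AE \<omega> in M. S \<omega> = T \<longrightarrow> \<tau> \<omega> = T)}"

text \<open>
  The \<open>\<sigma>\<close>-field of events strictly before \<open>S\<close>. The library's \<^const>\<open>filtration.pre_sigma\<close>
  is, despite its name, the \<open>\<sigma>\<close>-field of events up to and including \<open>S\<close>.
\<close>

definition strict_past ::
  "'a measure \<Rightarrow> (real \<Rightarrow> 'a measure) \<Rightarrow> real \<Rightarrow> ('a \<Rightarrow> real) \<Rightarrow> 'a measure"
where
  "strict_past M F T S = sigma (space M)
     (sets (F 0) \<union> {A \<inter> {\<omega> \<in> space M. t < S \<omega>} | A t. t \<in> {0..T} \<and> A \<in> sets (F t)})"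

definition quasi_left_continuous :: "'a measure \<Rightarrow> (real \<Rightarrow> 'a measure) \<Rightarrow> real \<Rightarrow> bool"
where
  "quasi_left_continuous M F T \<longleftrightarrow>
     (\<forall>\<tau>\<in>pred_times M F T. sets (strict_past M F T \<tau>) = sets (filtration.pre_sigma (space M) F \<tau>))"

locale usual_filtered_prob_space = prob_space M + filtration "space M" F
  for M :: "'a measure" and F :: "real \<Rightarrow> 'a measure" +
  fixes T :: real
  assumes T_pos: "0 < T"
    and sets_F_subset: "\<And>t. t \<in> {0..T} \<Longrightarrow> sets (F t) \<subseteq> sets M"
    and right_continuous: "\<And>t. t \<in> {0..<T} \<Longrightarrow> sets (F t) = (\<Inter>s\<in>{t<..T}. sets (F s))"
    and complete: "\<And>N A. N \<in> null_sets M \<Longrightarrow> A \<subseteq> N \<Longrightarrow> A \<in> sets (F 0)"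
    and F_0_trivial: "\<And>A. A \<in> sets (F 0) \<Longrightarrow> prob A = 0 \<or> prob A = 1"
    and not_quasi_left_continuous: "\<not> quasi_left_continuous M F T"

definition admissible ::
  "'a measure \<Rightarrow> (real \<Rightarrow> 'a measure) \<Rightarrow> real \<Rightarrow> (('a \<Rightarrow> real) \<Rightarrow> 'a \<Rightarrow> ennreal) \<Rightarrow> bool"
where
  "admissible M F T \<phi> \<longleftrightarrow>
     (\<forall>\<tau>\<in>pred_times M F T. \<phi> \<tau> \<in> borel_measurable (strict_past M F T \<tau>)) \<and>
     (\<forall>\<tau>\<in>pred_times M F T. \<forall>\<tau>'\<in>pred_times M F T.
        AE \<omega> in M. \<tau> \<omega> = \<tau>' \<omega> \<longrightarrow> \<phi> \<tau> \<omega> = \<phi> \<tau>' \<omega>)"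

text \<open>
  Essential supremum of a family of random variables, unlike the library's \<^const>\<open>esssup\<close>
  of a single function. It is an \<open>M\<close>-measurable function, determined up to null sets;
  \<open>ess_sup_family\<close> is an arbitrary version.
\<close>

definition is_ess_sup_family :: "'a measure \<Rightarrow> ('a \<Rightarrow> ennreal) set \<Rightarrow> ('a \<Rightarrow> ennreal) \<Rightarrow> bool"
where
  "is_ess_sup_family M \<X> Z \<longleftrightarrow>
     Z \<in> borel_measurable M \<and> (\<forall>X\<in>\<X>. AE \<omega> in M. X \<omega> \<le> Z \<omega>) \<and>
     (\<forall>Y\<in>borel_measurable M. (\<forall>X\<in>\<X>. AE \<omega> in M. X \<omega> \<le> Y \<omega>) \<longrightarrow> (AE \<omega> in M. Z \<omega> \<le> Y \<omega>))"

definition ess_sup_family :: "'a measure \<Rightarrow> ('a \<Rightarrow> ennreal) set \<Rightarrow> 'a \<Rightarrow> ennreal"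
where
  "ess_sup_family M \<X> = (SOME Z. is_ess_sup_family M \<X> Z)"

definition value_family ::
  "'a measure \<Rightarrow> (real \<Rightarrow> 'a measure) \<Rightarrow> real \<Rightarrow> (('a \<Rightarrow> real) \<Rightarrow> 'a \<Rightarrow> ennreal) \<Rightarrow>
   ('a \<Rightarrow> real) \<Rightarrow> 'a \<Rightarrow> ennreal"
where
  "value_family M F T \<phi> S =
     ess_sup_family M ((\<lambda>\<tau>. nn_cond_exp M (strict_past M F T S) (\<phi> \<tau>)) ` pred_times_from M F T S)"

definition strict_value_family ::
  "'a measure \<Rightarrow> (real \<Rightarrow> 'a measure) \<Rightarrow> real \<Rightarrow> (('a \<Rightarrow> real) \<Rightarrow> 'a \<Rightarrow> ennreal) \<Rightarrow>
   ('a \<Rightarrow> real) \<Rightarrow> 'a \<Rightarrow> ennreal"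
where
  "strict_value_family M F T \<phi> S =
     ess_sup_family M ((\<lambda>\<tau>. nn_cond_exp M (strict_past M F T S) (\<phi> \<tau>)) ` pred_times_after M F T S)"

end

theory Submission
  imports Defs
begin

text \<open>
  Measurability of the value families is a matter of null sets. An essential supremum is attained by
  a countable subfamily (\<open>countable_subfamily_attains_ess_sup\<close>), so it is almost surely equal to a
  countable supremum of \<open>F\<^bsub>S-\<^esub>\<close>-measurable conditional expectations; as \<open>F\<^bsub>S-\<^esub>\<close> contains all null
  sets, every version of it is \<open>F\<^bsub>S-\<^esub>\<close>-measurable.

  For the compatibility let \<open>A = {S = S'}\<close>. This event lies in both \<open>F\<^bsub>S-\<^esub>\<close> and \<open>F\<^bsub>S'-\<^esub>\<close>
  (\<open>pred_times_eq_in_strict_past\<close>; this uses predictability), and the two \<open>\<sigma>\<close>-fields have the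
  same trace on \<open>A\<close> (\<open>strict_past_trace\<close>). A competitor \<open>\<tau>\<close> for \<open>S\<close> is turned into a competitor
  for \<open>S'\<close> by setting \<open>\<tau>\<^sub>A = \<tau>\<close> on \<open>A\<close> and \<open>\<tau>\<^sub>A = T\<close> off \<open>A\<close>; it is predictable because
  \<open>A \<in> F\<^bsub>S-\<^esub>\<close> and \<open>S \<le> \<tau>\<close> almost surely (\<open>pred_times_restrict\<close>). Admissibility of \<open>\<phi>\<close> gives
  \<open>\<phi>(\<tau>) = \<phi>(\<tau>\<^sub>A)\<close> on \<open>A\<close>, and locality of conditional expectations (\<open>nn_cond_exp_local\<close>) gives
  \<open>E[\<phi>(\<tau>) | F\<^bsub>S-\<^esub>] = E[\<phi>(\<tau>\<^sub>A) | F\<^bsub>S'-\<^esub>]\<close> on \<open>A\<close>. Hence on \<open>A\<close> the value at \<open>S\<close> is at most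
  the value at \<open>S'\<close>, and by symmetry they agree there. The argument is the same for both families,
  which differ only in their sets of competitors (\<open>admissible_ess_sup_cond_exp\<close>).
\<close>

section \<open>Essential suprema\<close>

lemma is_ess_sup_familyD:
  assumes "is_ess_sup_family M \<X> Z"
  shows is_ess_sup_family_measurable: "Z \<in> borel_measurable M"
    and is_ess_sup_family_upper: "X \<in> \<X> \<Longrightarrow> AE \<omega> in M. X \<omega> \<le> Z \<omega>"
    and is_ess_sup_family_least:
      "Y \<in> borel_measurable M \<Longrightarrow> (\<And>X. X \<in> \<X> \<Longrightarrow> AE \<omega> in M. X \<omega> \<le> Y \<omega>) \<Longrightarrow> AE \<omega> in M. Z \<omega> \<le> Y \<omega>"
  using assms by (simp_all add: is_ess_sup_family_def)

lemma is_ess_sup_family_unique: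
  assumes "is_ess_sup_family M \<X> Z" "is_ess_sup_family M \<X> Z'"
  shows "AE \<omega> in M. Z \<omega> = Z' \<omega>"
proof -
  have "AE \<omega> in M. Z \<omega> \<le> Z' \<omega>"
    using is_ess_sup_familyD(1,2)[OF assms(2)] by (rule is_ess_sup_family_least[OF assms(1)])
  moreover have "AE \<omega> in M. Z' \<omega> \<le> Z \<omega>"
    using is_ess_sup_familyD(1,2)[OF assms(1)] by (rule is_ess_sup_family_least[OF assms(2)])
  ultimately show ?thesis
    by eventually_elim (rule antisym)
qed

text \<open>
  \<open>x \<mapsto> 1 / (1 + x)\<close> is a strictly decreasing map of \<open>[0,\<infinity>]\<close> into \<open>[0,1]\<close>, so that integrals
  of it over a finite measure can be compared without integrability assumptions.
\<close>

lemma inverse_one_plus_le_iff: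
  fixes x y :: ennreal
  shows "inverse (1 + x) \<le> inverse (1 + y) \<longleftrightarrow> y \<le> x"
proof (cases x; cases y)
  fix r s assume "0 \<le> r" "x = ennreal r" "0 \<le> s" "y = ennreal s"
  then show ?thesis
    by (simp add: inverse_ennreal ennreal_plus[symmetric] ennreal_1[symmetric] del: ennreal_plus ennreal_1)
qed (auto simp: top_unique)

text \<open>
  Exhaustion: choose a countable subfamily \<open>C\<close> that minimises the integral \<open>J C\<close> of
  \<open>1 / (1 + sup C)\<close>. Adding a further member of the family to \<open>C\<close> cannot lower the integral,
  hence almost surely does not raise the supremum.
\<close>

lemma (in finite_measure) countable_subfamily_attains_ess_sup:
  fixes \<X> :: "('a \<Rightarrow> ennreal) set"
  assumes meas: "\<X> \<subseteq> borel_measurable M"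
  obtains C where "countable C" "C \<subseteq> \<X>" "is_ess_sup_family M \<X> (\<lambda>\<omega>. SUP X\<in>C. X \<omega>)"
proof -
  let ?s = "\<lambda>C \<omega>. SUP X\<in>C. X \<omega> :: ennreal"
  let ?\<C> = "{C. countable C \<and> C \<subseteq> \<X>}"
  define J where "J C = (\<integral>\<^sup>+\<omega>. inverse (1 + ?s C \<omega>) \<partial>M)" for C
  have s_meas: "?s C \<in> borel_measurable M" if "C \<in> ?\<C>" for C
    using that meas by (intro borel_measurable_SUP) auto
  have g_meas: "(\<lambda>\<omega>. inverse (1 + ?s C \<omega>)) \<in> borel_measurable M" if "C \<in> ?\<C>" for C
    using s_meas[OF that] by measurable
  have g_mono: "inverse (1 + ?s D \<omega>) \<le> inverse (1 + ?s C \<omega>)" if "C \<subseteq> D" for C D \<omega>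
    using that by (simp add: inverse_one_plus_le_iff SUP_subset_mono)
  have "J ` ?\<C> \<noteq> {}"
    by auto
  from ennreal_Inf_countable_INF[OF this] obtain f :: "nat \<Rightarrow> ennreal"
    where f: "range f \<subseteq> J ` ?\<C>" "Inf (J ` ?\<C>) = (INF i. f i)"
    by blast
  then have "\<forall>i. \<exists>C\<in>?\<C>. f i = J C"
    by blast
  then obtain c where c: "\<And>i. c i \<in> ?\<C>" "\<And>i. f i = J (c i)"
    by metis
  let ?C = "\<Union>i. c i"
  have C: "?C \<in> ?\<C>"
    using c(1) by (auto intro: countable_UN)
  have J_min: "J ?C \<le> J D" if "D \<in> ?\<C>" for D
  proof -
    have "J ?C \<le> f i" for i
      unfolding c(2) J_def by (intro nn_integral_mono g_mono) auto
    then have "J ?C \<le> Inf (J ` ?\<C>)"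
      unfolding f(2) by (rule INF_greatest)
    also have "\<dots> \<le> J D"
      using that by (rule INF_lower)
    finally show ?thesis .
  qed
  have upper: "AE \<omega> in M. X \<omega> \<le> ?s ?C \<omega>" if "X \<in> \<X>" for X
  proof -
    let ?D = "insert X ?C"
    have D: "?D \<in> ?\<C>"
      using C that by auto
    have fin: "J ?D \<noteq> \<infinity>"
    proof -
      have "J ?D \<le> (\<integral>\<^sup>+\<omega>. 1 \<partial>M)"
        unfolding J_def
      proof (rule nn_integral_mono)
        show "inverse (1 + ?s ?D \<omega>) \<le> 1" for \<omega>
          using inverse_one_plus_le_iff[of "?s ?D \<omega>" 0] by simp
      qed
      also have "\<dots> < \<infinity>"
        using emeasure_finite[of "space M"] by (simp add: less_top[symmetric])
      finally show ?thesis
        by auto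
    qed
    have "AE \<omega> in M. inverse (1 + ?s ?C \<omega>) \<le> inverse (1 + ?s ?D \<omega>)"
    proof (rule ccontr)
      assume not_AE: "\<not> ?thesis"
      have "J ?D < J ?C"
        unfolding J_def
      proof (rule nn_integral_less[OF g_meas[OF D] g_meas[OF C]])
        show "(\<integral>\<^sup>+\<omega>. inverse (1 + ?s ?D \<omega>) \<partial>M) \<noteq> \<infinity>"
          by (rule fin[unfolded J_def])
        show "AE \<omega> in M. inverse (1 + ?s ?D \<omega>) \<le> inverse (1 + ?s ?C \<omega>)"
          by (rule AE_I2) (rule g_mono, rule subset_insertI)
      qed (rule not_AE)
      with J_min[OF D] show False
        by (rule leD[THEN notE])
    qed
    then show ?thesis
    proof eventually_elim
      case (elim \<omega>)
      then have "?s ?D \<omega> \<le> ?s ?C \<omega>"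
        by (simp only: inverse_one_plus_le_iff)
      moreover have "X \<omega> \<le> ?s ?D \<omega>"
        by (rule SUP_upper) simp
      ultimately show ?case
        by (rule order_trans[rotated])
    qed
  qed
  have least: "AE \<omega> in M. ?s ?C \<omega> \<le> Y \<omega>"
    if "\<And>X. X \<in> \<X> \<Longrightarrow> AE \<omega> in M. X \<omega> \<le> Y \<omega>" for Y
  proof -
    have "AE \<omega> in M. \<forall>X\<in>?C. X \<omega> \<le> Y \<omega>"
      using C that by (subst AE_ball_countable) auto
    then show ?thesis
      by eventually_elim (rule SUP_least, blast)
  qed
  show ?thesis
  proof (rule that)
    show "is_ess_sup_family M \<X> (?s ?C)"
      unfolding is_ess_sup_family_def using s_meas[OF C] upper least by simp
  qed (use C in auto)
qed

lemma (in finite_measure) ess_sup_family_is_ess_sup: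
  assumes "\<X> \<subseteq> borel_measurable M"
  shows "is_ess_sup_family M \<X> (ess_sup_family M \<X>)"
proof -
  obtain C where "is_ess_sup_family M \<X> (\<lambda>\<omega>. SUP X\<in>C. X \<omega>)"
    by (rule countable_subfamily_attains_ess_sup[OF assms])
  then show ?thesis
    unfolding ess_sup_family_def by (rule someI[of "is_ess_sup_family M \<X>"])
qed

lemma borel_measurable_AE_version:
  fixes f g :: "'a \<Rightarrow> 'b::topological_space"
  assumes G: "subalgebra M G"
    and null: "\<And>N A. N \<in> null_sets M \<Longrightarrow> A \<subseteq> N \<Longrightarrow> A \<in> sets G"
    and g: "g \<in> borel_measurable G" and eq: "AE \<omega> in M. f \<omega> = g \<omega>"
  shows "f \<in> borel_measurable G"
proof (rule measurableI)
  from eq obtain N where N: "N \<in> null_sets M" "{\<omega>\<in>space M. f \<omega> \<noteq> g \<omega>} \<subseteq> N"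
    by (auto elim: AE_E simp: null_sets_def)
  fix B :: "'b set" assume B: "B \<in> sets borel"
  have "f -` B \<inter> space G = (g -` B \<inter> space G - N) \<union> (f -` B \<inter> space G \<inter> N)"
    using N(2) G by (auto simp: subalgebra_def)
  moreover have "g -` B \<inter> space G \<in> sets G"
    using g B by (rule measurable_sets)
  ultimately show "f -` B \<inter> space G \<in> sets G"
    using null[OF N(1) order_refl] null[OF N(1), of "f -` B \<inter> space G \<inter> N"]
    by (metis sets.Un sets.Diff Int_lower2)
qed auto

lemma (in finite_measure) borel_measurable_ess_sup_family:
  assumes G: "subalgebra M G"
    and null: "\<And>N A. N \<in> null_sets M \<Longrightarrow> A \<subseteq> N \<Longrightarrow> A \<in> sets G"
    and meas: "\<X> \<subseteq> borel_measurable G"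
  shows "ess_sup_family M \<X> \<in> borel_measurable G"
proof -
  have M: "\<X> \<subseteq> borel_measurable M"
    using meas measurable_from_subalg[OF G] by blast
  obtain C where C: "countable C" "C \<subseteq> \<X>" "is_ess_sup_family M \<X> (\<lambda>\<omega>. SUP X\<in>C. X \<omega>)"
    by (rule countable_subfamily_attains_ess_sup[OF M])
  have "(\<lambda>\<omega>. SUP X\<in>C. X \<omega>) \<in> borel_measurable G"
    using C meas by (intro borel_measurable_SUP) auto
  from borel_measurable_AE_version[OF G null this
      is_ess_sup_family_unique[OF ess_sup_family_is_ess_sup[OF M] C(3)]]
  show ?thesis .
qed

text \<open>
  The comparison is localised to \<open>A\<close> by testing minimality of \<open>Z\<close> against the upper bound that
  is \<open>Z'\<close> on \<open>A\<close> and \<open>\<infinity>\<close> elsewhere.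
\<close>

lemma ess_sup_family_le_on:
  fixes Z Z' :: "'a \<Rightarrow> ennreal"
  assumes Z: "is_ess_sup_family M \<X> Z" and Z': "is_ess_sup_family M \<X>' Z'"
    and A: "A \<in> sets M"
    and dom: "\<And>X. X \<in> \<X> \<Longrightarrow> \<exists>X'\<in>\<X>'. AE \<omega> in M. \<omega> \<in> A \<longrightarrow> X \<omega> \<le> X' \<omega>"
  shows "AE \<omega> in M. \<omega> \<in> A \<longrightarrow> Z \<omega> \<le> Z' \<omega>"
proof -
  let ?Y = "\<lambda>\<omega>. if \<omega> \<in> A then Z' \<omega> else \<infinity>"
  have "?Y \<in> borel_measurable M"
    using is_ess_sup_family_measurable[OF Z'] A by (intro measurable_If_set) auto
  moreover have "AE \<omega> in M. X \<omega> \<le> ?Y \<omega>" if "X \<in> \<X>" for X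
  proof -
    obtain X' where X': "X' \<in> \<X>'" "AE \<omega> in M. \<omega> \<in> A \<longrightarrow> X \<omega> \<le> X' \<omega>"
      using dom[OF \<open>X \<in> \<X>\<close>] by blast
    have "AE \<omega> in M. X' \<omega> \<le> Z' \<omega>"
      using Z' X'(1) by (rule is_ess_sup_family_upper)
    with X'(2) show ?thesis
      by eventually_elim auto
  qed
  ultimately have "AE \<omega> in M. Z \<omega> \<le> ?Y \<omega>"
    by (rule is_ess_sup_family_least[OF Z])
  then show ?thesis
    by eventually_elim (simp split: if_splits)
qed

section \<open>Locality of conditional expectations\<close>

text \<open>
  The function \<open>h\<close> that is \<open>E[f|F]\<close> on \<open>A\<close> and \<open>E[g|G]\<close> off \<open>A\<close> is \<open>G\<close>-measurable since the
  traces of \<open>F\<close> and \<open>G\<close> on \<open>A\<close> agree, and it has the same integrals as \<open>g\<close> over the sets of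
  \<open>G\<close>; so it is a version of \<open>E[g|G]\<close>.
\<close>

lemma (in finite_measure) nn_cond_exp_local:
  assumes F: "subalgebra M F" and G: "subalgebra M G"
    and A: "A \<in> sets G"
    and trace: "\<And>B. B \<in> sets F \<Longrightarrow> B \<inter> A \<in> sets G" "\<And>B. B \<in> sets G \<Longrightarrow> B \<inter> A \<in> sets F"
    and f[measurable]: "f \<in> borel_measurable M" and g[measurable]: "g \<in> borel_measurable M"
    and eq: "AE \<omega> in M. \<omega> \<in> A \<longrightarrow> f \<omega> = g \<omega>"
  shows "AE \<omega> in M. \<omega> \<in> A \<longrightarrow> nn_cond_exp M F f \<omega> = nn_cond_exp M G g \<omega>"
proof -
  interpret F: finite_measure_subalgebra M F by unfold_locales (rule F)
  interpret G: finite_measure_subalgebra M G by unfold_locales (rule G)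
  let ?h = "\<lambda>\<omega>. if \<omega> \<in> A then nn_cond_exp M F f \<omega> else nn_cond_exp M G g \<omega>"
  have h: "?h \<in> borel_measurable G"
  proof (rule measurableI)
    fix B :: "ennreal set" assume B: "B \<in> sets borel"
    have "?h -` B \<inter> space G =
        (nn_cond_exp M F f -` B \<inter> space F) \<inter> A \<union> (nn_cond_exp M G g -` B \<inter> space G - A)"
      using F G by (auto simp: subalgebra_def split: if_splits)
    moreover have "(nn_cond_exp M F f -` B \<inter> space F) \<inter> A \<in> sets G"
      by (rule trace(1)[OF measurable_sets[OF borel_measurable_nn_cond_exp B]])
    moreover have "nn_cond_exp M G g -` B \<inter> space G \<in> sets G"
      by (rule measurable_sets[OF borel_measurable_nn_cond_exp B])
    ultimately show "?h -` B \<inter> space G \<in> sets G"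
      using A by auto
  qed auto
  have "AE \<omega> in M. ?h \<omega> = nn_cond_exp M G g \<omega>"
  proof (rule G.nn_cond_exp_charact[OF _ g h])
    fix B assume B: "B \<in> sets G"
    have AB: "B \<inter> A \<in> sets F" "B - A \<in> sets G"
      using trace(2)[OF B] A B by auto
    have ABM[measurable]: "B \<inter> A \<in> sets M" "B - A \<in> sets M"
      using AB F G by (auto simp: subalgebra_def)
    have "(\<integral>\<^sup>+\<omega>\<in>B. g \<omega> \<partial>M) =
        (\<integral>\<^sup>+\<omega>. indicator (B \<inter> A) \<omega> * f \<omega> + indicator (B - A) \<omega> * g \<omega> \<partial>M)"
      using eq by (intro nn_integral_cong_AE) (auto simp: indicator_def)
    also have "\<dots> = (\<integral>\<^sup>+\<omega>. indicator (B \<inter> A) \<omega> * f \<omega> \<partial>M) + (\<integral>\<^sup>+\<omega>. indicator (B - A) \<omega> * g \<omega> \<partial>M)"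
      by (rule nn_integral_add) measurable
    also have "(\<integral>\<^sup>+\<omega>. indicator (B \<inter> A) \<omega> * f \<omega> \<partial>M) =
        (\<integral>\<^sup>+\<omega>. indicator (B \<inter> A) \<omega> * nn_cond_exp M F f \<omega> \<partial>M)"
      using AB by (intro F.nn_cond_exp_intg[symmetric]) auto
    also have "(\<integral>\<^sup>+\<omega>. indicator (B - A) \<omega> * g \<omega> \<partial>M) =
        (\<integral>\<^sup>+\<omega>. indicator (B - A) \<omega> * nn_cond_exp M G g \<omega> \<partial>M)"
      using AB by (intro G.nn_cond_exp_intg[symmetric]) auto
    also have "(\<integral>\<^sup>+\<omega>. indicator (B \<inter> A) \<omega> * nn_cond_exp M F f \<omega> \<partial>M) +
          (\<integral>\<^sup>+\<omega>. indicator (B - A) \<omega> * nn_cond_exp M G g \<omega> \<partial>M) =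
        (\<integral>\<^sup>+\<omega>. indicator (B \<inter> A) \<omega> * nn_cond_exp M F f \<omega> +
          indicator (B - A) \<omega> * nn_cond_exp M G g \<omega> \<partial>M)"
      by (rule nn_integral_add[symmetric]) measurable
    also have "\<dots> = (\<integral>\<^sup>+\<omega>\<in>B. ?h \<omega> \<partial>M)"
      by (intro nn_integral_cong) (auto simp: indicator_def)
    finally show "(\<integral>\<^sup>+\<omega>\<in>B. g \<omega> \<partial>M) = (\<integral>\<^sup>+\<omega>\<in>B. ?h \<omega> \<partial>M)" .
  qed
  then show ?thesis
    by eventually_elim auto
qed

section \<open>Predictable times and the strict past\<close>

context usual_filtered_prob_space
begin

lemma sets_F_space: "A \<in> sets (F t) \<Longrightarrow> A \<subseteq> space M"
  using sets.sets_into_space[of A "F t"] by (simp add: space_F)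

lemma strict_past_generators_Pow:
  "sets (F 0) \<union> {A \<inter> {\<omega> \<in> space M. t < S \<omega>} | A t. t \<in> {0..T} \<and> A \<in> sets (F t)} \<subseteq> Pow (space M)"
  using sets_F_space by blast

lemma predictable_generators_Pow:
  "{A \<times> {0} | A. A \<in> sets (F 0)} \<union>
     {A \<times> {s<..t} | A s t. 0 \<le> s \<and> s < t \<and> t \<le> T \<and> A \<in> sets (F s)} \<subseteq> Pow (space M \<times> {0..T})"
  using sets_F_space[THEN subsetD] T_pos by auto

lemma space_strict_past [simp]: "space (strict_past M F T S) = space M"
  unfolding strict_past_def by (rule space_measure_of[OF strict_past_generators_Pow])

lemma sets_strict_past:
  "sets (strict_past M F T S) = sigma_sets (space M)
     (sets (F 0) \<union> {A \<inter> {\<omega> \<in> space M. t < S \<omega>} | A t. t \<in> {0..T} \<and> A \<in> sets (F t)})"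
  unfolding strict_past_def by (rule sets_measure_of[OF strict_past_generators_Pow])

lemma space_predictable_sigma [simp]: "space (predictable_sigma M F T) = space M \<times> {0..T}"
  unfolding predictable_sigma_def by (rule space_measure_of[OF predictable_generators_Pow])

lemma F0_in_strict_past: "A \<in> sets (F 0) \<Longrightarrow> A \<in> sets (strict_past M F T S)"
  unfolding sets_strict_past by (rule sigma_sets.Basic) blast

lemma before_in_strict_past:
  "t \<in> {0..T} \<Longrightarrow> A \<in> sets (F t) \<Longrightarrow> A \<inter> {\<omega> \<in> space M. t < S \<omega>} \<in> sets (strict_past M F T S)"
  unfolding sets_strict_past by (rule sigma_sets.Basic) blast

lemma predictable_rect_0: "A \<in> sets (F 0) \<Longrightarrow> A \<times> {0} \<in> sets (predictable_sigma M F T)"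
  unfolding predictable_sigma_def sets_measure_of[OF predictable_generators_Pow]
  by (rule sigma_sets.Basic) blast

lemma predictable_rect:
  "0 \<le> s \<Longrightarrow> s < t \<Longrightarrow> t \<le> T \<Longrightarrow> A \<in> sets (F s) \<Longrightarrow> A \<times> {s<..t} \<in> sets (predictable_sigma M F T)"
  unfolding predictable_sigma_def sets_measure_of[OF predictable_generators_Pow]
  by (rule sigma_sets.Basic) blast

lemma predictable_rect_all: "A \<in> sets (F 0) \<Longrightarrow> A \<times> {0..T} \<in> sets (predictable_sigma M F T)"
proof -
  assume A: "A \<in> sets (F 0)"
  have "A \<times> {0..T} = A \<times> {0} \<union> A \<times> {0<..T}"
    using T_pos by auto
  then show ?thesis
    using predictable_rect_0[OF A] predictable_rect[OF order_refl T_pos order_refl A] by auto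
qed

lemma stopping_time_greater: "stopping_time F S \<Longrightarrow> {\<omega> \<in> space M. t < S \<omega>} \<in> sets (F t)"
  using stopping_timeD2[of F S t] by (simp add: Measurable.pred_def space_F)

lemma subalgebra_strict_past:
  assumes "stopping_time F S"
  shows "subalgebra M (strict_past M F T S)"
proof -
  have "sets (strict_past M F T S) \<subseteq> sets M"
    unfolding sets_strict_past
  proof (rule sets.sigma_sets_subset, safe)
    show "A \<in> sets M" if "A \<in> sets (F 0)" for A
      using that sets_F_subset[of 0] T_pos by auto
    show "A \<inter> {\<omega> \<in> space M. t < S \<omega>} \<in> sets M" if "t \<in> {0..T}" "A \<in> sets (F t)" for A t
      using that stopping_time_greater[OF assms] sets_F_subset[of t] by blast
  qed
  then show ?thesis
    by (simp add: subalgebra_def)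
qed

lemma null_in_strict_past:
  "N \<in> null_sets M \<Longrightarrow> A \<subseteq> N \<Longrightarrow> A \<in> sets (strict_past M F T S)"
  by (intro F0_in_strict_past complete)

text \<open>
  Predictable processes are adapted.
\<close>

lemma predictable_section:
  assumes B: "B \<in> sets (predictable_sigma M F T)" and t: "t \<in> {0..T}"
  shows "{\<omega> \<in> space M. (\<omega>, t) \<in> B} \<in> sets (F t)"
proof -
  have "(\<lambda>\<omega>. (\<omega>, t)) \<in> F t \<rightarrow>\<^sub>M predictable_sigma M F T"
    unfolding predictable_sigma_def
  proof (rule measurable_measure_of[OF predictable_generators_Pow])
    show "(\<lambda>\<omega>. (\<omega>, t)) \<in> space (F t) \<rightarrow> space M \<times> {0..T}"
      using t by (simp add: space_F)
    have 0: "(\<lambda>\<omega>. (\<omega>, t)) -` (A \<times> {0}) \<inter> space (F t) \<in> sets (F t)" if "A \<in> sets (F 0)" for A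
    proof (cases "t = 0")
      case True
      then have "(\<lambda>\<omega>. (\<omega>, t)) -` (A \<times> {0}) \<inter> space (F t) = A"
        using sets_F_space[OF that] by (auto simp: space_F)
      with that True show ?thesis
        by simp
    qed auto
    have 1: "(\<lambda>\<omega>. (\<omega>, t)) -` (A \<times> {s<..u}) \<inter> space (F t) \<in> sets (F t)" if "A \<in> sets (F s)" for A s u
    proof (cases "t \<in> {s<..u}")
      case True
      then have "(\<lambda>\<omega>. (\<omega>, t)) -` (A \<times> {s<..u}) \<inter> space (F t) = A"
        using sets_F_space[OF that] by (auto simp: space_F)
      with that True sets_F_mono[of s t] show ?thesis
        by auto
    qed auto
    show "(\<lambda>\<omega>. (\<omega>, t)) -` y \<inter> space (F t) \<in> sets (F t)"
      if "y \<in> {A \<times> {0} |A. A \<in> sets (F 0)} \<union>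
        {A \<times> {s<..t} |A s t. 0 \<le> s \<and> s < t \<and> t \<le> T \<and> A \<in> sets (F s)}" for y
      using that 0 1 by blast
  qed
  from measurable_sets[OF this B] show ?thesis
    by (simp add: space_F vimage_def Int_def conj_commute)
qed

text \<open>
  A time with predictable interval \<open>[\<tau>,T]\<close> is automatically a stopping time, since \<open>{\<tau> \<le> t}\<close> is
  the section of that interval at \<open>t\<close>.
\<close>

lemma pred_timesI:
  assumes range: "\<And>\<omega>. \<omega> \<in> space M \<Longrightarrow> \<tau> \<omega> \<in> {0..T}"
    and graph: "{(\<omega>, t). \<omega> \<in> space M \<and> t \<in> {0..T} \<and> \<tau> \<omega> \<le> t} \<in> sets (predictable_sigma M F T)"
  shows "\<tau> \<in> pred_times M F T"
proof -
  have "{\<omega> \<in> space M. \<tau> \<omega> \<le> t} \<in> sets (F t)" for t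
  proof -
    consider "t < 0" | "t \<in> {0..T}" | "T < t"
      by force
    then show ?thesis
    proof cases
      case 1
      then have "{\<omega> \<in> space M. \<tau> \<omega> \<le> t} = {}"
        using range by force
      then show ?thesis
        by (simp only: sets.empty_sets)
    next
      case 2
      then show ?thesis
        using predictable_section[OF graph 2] by simp
    next
      case 3
      then have "{\<omega> \<in> space M. \<tau> \<omega> \<le> t} = space (F t)"
        using range by (force simp: space_F)
      then show ?thesis
        by (simp only: sets.top)
    qed
  qed
  then have "stopping_time F \<tau>"
    by (intro stopping_timeI) (simp add: Measurable.pred_def space_F)
  with assms show ?thesis
    by (simp add: pred_times_def)
qed

text \<open>
  A predictable process sampled at \<open>S\<close> is \<open>F\<^bsub>S-\<^esub>\<close>-measurable.
\<close>

lemma measurable_graph_strict_past: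
  assumes range: "\<And>\<omega>. \<omega> \<in> space M \<Longrightarrow> S \<omega> \<in> {0..T}"
  shows "(\<lambda>\<omega>. (\<omega>, S \<omega>)) \<in> strict_past M F T S \<rightarrow>\<^sub>M predictable_sigma M F T"
  unfolding predictable_sigma_def
proof (rule measurable_measure_of[OF predictable_generators_Pow])
  let ?G = "strict_past M F T S"
  show "(\<lambda>\<omega>. (\<omega>, S \<omega>)) \<in> space ?G \<rightarrow> space M \<times> {0..T}"
    using range by simp
  have 0: "(\<lambda>\<omega>. (\<omega>, S \<omega>)) -` (A \<times> {0}) \<inter> space ?G \<in> sets ?G" if A: "A \<in> sets (F 0)" for A
  proof -
    have "(\<lambda>\<omega>. (\<omega>, S \<omega>)) -` (A \<times> {0}) \<inter> space ?G = A - A \<inter> {\<omega> \<in> space M. 0 < S \<omega>}"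
      using sets_F_space[OF A] range by force
    then show ?thesis
      using F0_in_strict_past[OF A, of S] before_in_strict_past[of 0 A S] A T_pos by auto
  qed
  have 1: "(\<lambda>\<omega>. (\<omega>, S \<omega>)) -` (A \<times> {s<..t}) \<inter> space ?G \<in> sets ?G"
    if "0 \<le> s" "s < t" "t \<le> T" and A: "A \<in> sets (F s)" for A s t
  proof -
    have "(\<lambda>\<omega>. (\<omega>, S \<omega>)) -` (A \<times> {s<..t}) \<inter> space ?G =
        A \<inter> {\<omega> \<in> space M. s < S \<omega>} - A \<inter> {\<omega> \<in> space M. t < S \<omega>}"
      using sets_F_space[OF A] by auto
    moreover have "A \<in> sets (F t)"
      using A sets_F_mono[of s t] that by auto
    ultimately show ?thesis
      using before_in_strict_past[of s A S] before_in_strict_past[of t A S] that by auto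
  qed
  show "(\<lambda>\<omega>. (\<omega>, S \<omega>)) -` y \<inter> space ?G \<in> sets ?G"
    if "y \<in> {A \<times> {0} |A. A \<in> sets (F 0)} \<union>
      {A \<times> {s<..t} |A s t. 0 \<le> s \<and> s < t \<and> t \<le> T \<and> A \<in> sets (F s)}" for y
    using that 0 1 by blast
qed

text \<open>
  For any two stopping times, \<open>{S' < S}\<close> is strictly before \<open>S\<close>, by separating the two with a
  rational. That \<open>{S' \<le> S}\<close> is strictly before \<open>S\<close> too is where predictability of \<open>S'\<close> enters:
  it is the predictable set \<open>[S',T]\<close> sampled at \<open>S\<close>.
\<close>

lemma pred_times_eq_in_strict_past:
  assumes S: "S \<in> pred_times M F T" and S': "S' \<in> pred_times M F T"
  shows "{\<omega> \<in> space M. S \<omega> = S' \<omega>} \<in> sets (strict_past M F T S)"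
proof -
  let ?G = "strict_past M F T S"
  have range: "S \<omega> \<in> {0..T}" "S' \<omega> \<in> {0..T}" if "\<omega> \<in> space M" for \<omega>
    using S S' that by (auto simp: pred_times_def)
  have st: "stopping_time F S'"
    using S' by (simp add: pred_times_def)
  have "{(\<omega>, t). \<omega> \<in> space M \<and> t \<in> {0..T} \<and> S' \<omega> \<le> t} \<in> sets (predictable_sigma M F T)"
    using S' by (simp add: pred_times_def)
  from measurable_sets[OF measurable_graph_strict_past this]
  have "(\<lambda>\<omega>. (\<omega>, S \<omega>)) -` {(\<omega>, t). \<omega> \<in> space M \<and> t \<in> {0..T} \<and> S' \<omega> \<le> t} \<inter> space ?G \<in> sets ?G"
    using range by blast
  moreover have "(\<lambda>\<omega>. (\<omega>, S \<omega>)) -` {(\<omega>, t). \<omega> \<in> space M \<and> t \<in> {0..T} \<and> S' \<omega> \<le> t} \<inter> space ?G =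
      {\<omega> \<in> space M. S' \<omega> \<le> S \<omega>}"
    using range by auto
  ultimately have le: "{\<omega> \<in> space M. S' \<omega> \<le> S \<omega>} \<in> sets ?G"
    by simp
  have less: "{\<omega> \<in> space M. S' \<omega> < S \<omega>} \<in> sets ?G"
  proof -
    have "{\<omega> \<in> space M. S' \<omega> < S \<omega>} =
        (\<Union>q\<in>\<rat> \<inter> {0..T}. {\<omega> \<in> space M. S' \<omega> \<le> q} \<inter> {\<omega> \<in> space M. q < S \<omega>})"
    proof (intro set_eqI iffI)
      fix \<omega> assume "\<omega> \<in> {\<omega> \<in> space M. S' \<omega> < S \<omega>}"
      then have \<omega>: "\<omega> \<in> space M" "S' \<omega> < S \<omega>"
        by auto
      from Rats_dense_in_real[OF \<omega>(2)] obtain q where q: "q \<in> \<rat>" "S' \<omega> < q" "q < S \<omega>"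
        by blast
      moreover have "q \<in> {0..T}"
        using q range[OF \<omega>(1)] by auto
      ultimately show "\<omega> \<in> (\<Union>q\<in>\<rat> \<inter> {0..T}. {\<omega> \<in> space M. S' \<omega> \<le> q} \<inter> {\<omega> \<in> space M. q < S \<omega>})"
        using \<omega>(1) by fastforce
    qed auto
    moreover have "{\<omega> \<in> space M. S' \<omega> \<le> q} \<inter> {\<omega> \<in> space M. q < S \<omega>} \<in> sets ?G" if "q \<in> {0..T}" for q
      using stopping_timeD[OF st, of q] that
      by (intro before_in_strict_past) (simp_all add: Measurable.pred_def space_F)
    moreover have "countable (\<rat> \<inter> {0..T} :: real set)"
      using countable_rat by (rule countable_subset[rotated]) auto
    ultimately show ?thesis
      by (auto intro!: sets.countable_UN'')
  qed
  have "{\<omega> \<in> space M. S \<omega> = S' \<omega>} = {\<omega> \<in> space M. S' \<omega> \<le> S \<omega>} - {\<omega> \<in> space M. S' \<omega> < S \<omega>}"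
    by auto
  with le less show ?thesis
    by auto
qed

lemma strict_past_trace:
  assumes A: "{\<omega> \<in> space M. S \<omega> = S' \<omega>} \<in> sets (strict_past M F T S')"
    and B: "B \<in> sets (strict_past M F T S)"
  shows "B \<inter> {\<omega> \<in> space M. S \<omega> = S' \<omega>} \<in> sets (strict_past M F T S')"
  using B unfolding sets_strict_past[of S]
proof (induction rule: sigma_sets.induct)
  case (Basic B)
  then consider "B \<in> sets (F 0)"
    | C t where "B = C \<inter> {\<omega> \<in> space M. t < S \<omega>}" "t \<in> {0..T}" "C \<in> sets (F t)"
    by blast
  then show ?case
  proof cases
    case 1
    with A show ?thesis
      by (auto intro: F0_in_strict_past)
  next
    case 2
    have "B \<inter> {\<omega> \<in> space M. S \<omega> = S' \<omega>} =
        C \<inter> {\<omega> \<in> space M. t < S' \<omega>} \<inter> {\<omega> \<in> space M. S \<omega> = S' \<omega>}"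
      unfolding 2(1) by auto
    with A before_in_strict_past[OF 2(2,3), of S'] show ?thesis
      by auto
  qed
next
  case Empty
  then show ?case
    by simp
next
  case (Compl B)
  have "(space M - B) \<inter> {\<omega> \<in> space M. S \<omega> = S' \<omega>} =
      {\<omega> \<in> space M. S \<omega> = S' \<omega>} - B \<inter> {\<omega> \<in> space M. S \<omega> = S' \<omega>}"
    by auto
  with A Compl.IH show ?case
    by auto
next
  case (Union B)
  then show ?case
    by (simp only: UN_extend_simps) (rule sets.countable_UN, blast)
qed

text \<open>
  Restricting a predictable time to an event strictly before it leaves it predictable. For the
  generating event \<open>B = C \<inter> {r < S}\<close> with \<open>C \<in> F\<^sub>r\<close> the reason is that \<open>B \<in> F\<^sub>r\<close> and that on
  \<open>B\<close> the interval \<open>[S,T]\<close> lies after \<open>r\<close>, so that it is cut out by the rectangle \<open>B \<times> (r,T]\<close>.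
\<close>

lemma predictable_restriction:
  assumes S: "S \<in> pred_times M F T" and A: "A \<in> sets (strict_past M F T S)"
  shows "{(\<omega>, t). \<omega> \<in> A \<and> t \<in> {0..T} \<and> S \<omega> \<le> t} \<in> sets (predictable_sigma M F T)"
  using A unfolding sets_strict_past
proof (induction rule: sigma_sets.induct)
  let ?P = "predictable_sigma M F T"
  let ?gr = "{(\<omega>, t). \<omega> \<in> space M \<and> t \<in> {0..T} \<and> S \<omega> \<le> t}"
  have gr: "?gr \<in> sets ?P"
    using S by (simp add: pred_times_def)
  have st: "stopping_time F S"
    using S by (simp add: pred_times_def)
  {
    case (Basic B)
    then consider "B \<in> sets (F 0)"
      | C r where "B = C \<inter> {\<omega> \<in> space M. r < S \<omega>}" "r \<in> {0..T}" "C \<in> sets (F r)"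
      by blast
    then show ?case
    proof cases
      case 1
      have "{(\<omega>, t). \<omega> \<in> B \<and> t \<in> {0..T} \<and> S \<omega> \<le> t} = ?gr \<inter> B \<times> {0..T}"
        using sets_F_space[OF 1] by auto
      with gr predictable_rect_all[OF 1] show ?thesis
        by auto
    next
      case 2
      have B: "B \<in> sets (F r)"
        using 2 stopping_time_greater[OF st, of r] by auto
      have eq: "{(\<omega>, t). \<omega> \<in> B \<and> t \<in> {0..T} \<and> S \<omega> \<le> t} = ?gr \<inter> B \<times> {r<..T}"
        unfolding 2(1) using 2(2) by auto
      have "B \<times> {r<..T} \<in> sets ?P"
      proof (cases "r = T")
        case False
        with 2(2) B show ?thesis
          by (intro predictable_rect) auto
      qed simp
      with gr show ?thesis
        unfolding eq by auto
    qed
  next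
    case Empty
    then show ?case
      by simp
  next
    case (Compl B)
    have "{(\<omega>, t). \<omega> \<in> space M - B \<and> t \<in> {0..T} \<and> S \<omega> \<le> t} =
        ?gr - {(\<omega>, t). \<omega> \<in> B \<and> t \<in> {0..T} \<and> S \<omega> \<le> t}"
      by auto
    with gr Compl.IH show ?case
      by auto
  next
    case (Union B)
    have "{(\<omega>, t). \<omega> \<in> (\<Union>i. B i) \<and> t \<in> {0..T} \<and> S \<omega> \<le> t} =
        (\<Union>i. {(\<omega>, t). \<omega> \<in> B i \<and> t \<in> {0..T} \<and> S \<omega> \<le> t})"
      by auto
    with Union.IH show ?case
      by auto
  }
qed

lemma predictable_terminal: "space M \<times> {T} \<in> sets (predictable_sigma M F T)"
proof -
  have "space M \<times> {T} = (\<Inter>n. space M \<times> {T - T / real (Suc n) <.. T})"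
  proof (intro equalityI subsetI)
    fix x assume "x \<in> space M \<times> {T}"
    then show "x \<in> (\<Inter>n. space M \<times> {T - T / real (Suc n) <.. T})"
      using T_pos by (auto simp del: of_nat_Suc)
  next
    fix x assume "x \<in> (\<Inter>n. space M \<times> {T - T / real (Suc n) <.. T})"
    then obtain \<omega> t where x: "x = (\<omega>, t)" "\<omega> \<in> space M" "t \<le> T" "\<And>n. T - T / real (Suc n) < t"
      by (cases x) (auto simp del: of_nat_Suc)
    have "(\<lambda>n. T - T / real (Suc n)) \<longlonglongrightarrow> T - 0"
      by (intro tendsto_diff tendsto_const LIMSEQ_Suc lim_const_over_n)
    then have "T - 0 \<le> t"
      using x(4) by (intro LIMSEQ_le_const2) (auto intro: less_imp_le)
    with x show "x \<in> space M \<times> {T}"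
      by simp
  qed
  moreover have "space M \<times> {T - T / real (Suc n) <.. T} \<in> sets (predictable_sigma M F T)" for n
  proof (rule predictable_rect)
    show "0 \<le> T - T / real (Suc n)" "T - T / real (Suc n) < T"
      using T_pos by (simp_all add: field_simps)
    show "space M \<in> sets (F (T - T / real (Suc n)))"
      using sets.top[of "F (T - T / real (Suc n))"] by (simp add: space_F)
  qed simp
  ultimately show ?thesis
    by (auto intro!: sets.countable_INT')
qed

text \<open>
  As \<open>S \<le> \<tau>\<close>, the interval \<open>[\<tau>,T]\<close> over \<open>A\<close> is the intersection of \<open>[\<tau>,T]\<close> with the
  predictable interval \<open>[S,T]\<close> over \<open>A\<close>. The inequality holds only off a null set \<open>N\<close>; the part over
  \<open>A \<inter> N\<close> is added by hand, as all subsets of \<open>N\<close> are known at time 0.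
\<close>

lemma pred_times_restrict:
  assumes S: "S \<in> pred_times M F T" and A: "A \<in> sets (strict_past M F T S)"
    and \<tau>: "\<tau> \<in> pred_times_from M F T S"
  shows "(\<lambda>\<omega>. if \<omega> \<in> A then \<tau> \<omega> else T) \<in> pred_times M F T"
proof (rule pred_timesI)
  let ?P = "predictable_sigma M F T"
  let ?gr = "\<lambda>A \<tau>. {(\<omega>, t). \<omega> \<in> A \<and> t \<in> {0..T} \<and> \<tau> \<omega> \<le> t}"
  have \<tau>': "\<tau> \<in> pred_times M F T" "AE \<omega> in M. S \<omega> \<le> \<tau> \<omega>"
    using \<tau> by (auto simp: pred_times_from_def)
  then show "(if \<omega> \<in> A then \<tau> \<omega> else T) \<in> {0..T}" if "\<omega> \<in> space M" for \<omega>
    using that T_pos by (auto simp: pred_times_def)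
  from \<tau>'(2) obtain N where N: "N \<in> null_sets M" "{\<omega>\<in>space M. \<not> S \<omega> \<le> \<tau> \<omega>} \<subseteq> N"
    by (auto elim: AE_E simp: null_sets_def)
  have A_sub: "A \<subseteq> space M"
    using sets.sets_into_space[OF A] by simp
  have "A \<inter> N \<in> sets (F 0)"
    by (rule complete[OF N(1)]) simp
  then have AN: "(A \<inter> N) \<times> {0..T} \<in> sets ?P"
    by (rule predictable_rect_all)
  have gr_\<tau>: "?gr (space M) \<tau> \<in> sets ?P"
    using \<tau>'(1) by (simp add: pred_times_def)
  have "?gr (space M) (\<lambda>\<omega>. if \<omega> \<in> A then \<tau> \<omega> else T) =
      (?gr A S \<union> (A \<inter> N) \<times> {0..T}) \<inter> ?gr (space M) \<tau> \<union> space M \<times> {T}"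
    using N(2) A_sub T_pos \<tau>'(1) by (fastforce simp: pred_times_def split: if_splits)
  with predictable_restriction[OF S A] AN gr_\<tau> predictable_terminal
  show "?gr (space M) (\<lambda>\<omega>. if \<omega> \<in> A then \<tau> \<omega> else T) \<in> sets ?P"
    by auto
qed

section \<open>Admissibility of the value families\<close>

text \<open>
  The common argument for both value families, \<open>\<K> S\<close> being the set of competitors at \<open>S\<close>.
\<close>

lemma admissible_ess_sup_cond_exp:
  assumes \<phi>: "admissible M F T \<phi>"
    and sub: "\<And>S. S \<in> pred_times M F T \<Longrightarrow> \<K> S \<subseteq> pred_times_from M F T S"
    and paste: "\<And>S S' \<tau>. S \<in> pred_times M F T \<Longrightarrow> S' \<in> pred_times M F T \<Longrightarrow> \<tau> \<in> \<K> S \<Longrightarrow>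
      (\<lambda>\<omega>. if \<omega> \<in> {\<omega> \<in> space M. S \<omega> = S' \<omega>} then \<tau> \<omega> else T) \<in> pred_times M F T \<Longrightarrow>
      (\<lambda>\<omega>. if \<omega> \<in> {\<omega> \<in> space M. S \<omega> = S' \<omega>} then \<tau> \<omega> else T) \<in> \<K> S'"
  shows "admissible M F T
    (\<lambda>S. ess_sup_family M ((\<lambda>\<tau>. nn_cond_exp M (strict_past M F T S) (\<phi> \<tau>)) ` \<K> S))"
proof -
  let ?G = "strict_past M F T"
  let ?\<X> = "\<lambda>S. (\<lambda>\<tau>. nn_cond_exp M (?G S) (\<phi> \<tau>)) ` \<K> S"
  let ?V = "\<lambda>S. ess_sup_family M (?\<X> S)"
  have G: "subalgebra M (?G S)" if "S \<in> pred_times M F T" for S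
    using that by (intro subalgebra_strict_past) (simp add: pred_times_def)
  have V: "is_ess_sup_family M (?\<X> S) (?V S)" for S
    by (rule ess_sup_family_is_ess_sup) auto
  have \<phi>M: "\<phi> \<tau> \<in> borel_measurable M" if "\<tau> \<in> pred_times M F T" for \<tau>
    using \<phi> measurable_from_subalg[OF G[OF that]] that by (auto simp: admissible_def)
  have le: "AE \<omega> in M. S \<omega> = S' \<omega> \<longrightarrow> ?V S \<omega> \<le> ?V S' \<omega>"
    if S: "S \<in> pred_times M F T" and S': "S' \<in> pred_times M F T" for S S'
  proof -
    let ?A = "{\<omega> \<in> space M. S \<omega> = S' \<omega>}"
    have A: "?A \<in> sets (?G S)" "?A \<in> sets (?G S')"
      using pred_times_eq_in_strict_past[OF S S'] pred_times_eq_in_strict_past[OF S' S]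
      by (simp_all add: eq_commute)
    have "AE \<omega> in M. \<omega> \<in> ?A \<longrightarrow> ?V S \<omega> \<le> ?V S' \<omega>"
    proof (rule ess_sup_family_le_on[OF V V])
      show "?A \<in> sets M"
        using A(1) G[OF S] by (auto simp: subalgebra_def)
      fix X assume "X \<in> ?\<X> S"
      then obtain \<tau> where \<tau>: "\<tau> \<in> \<K> S" and X: "X = nn_cond_exp M (?G S) (\<phi> \<tau>)"
        by blast
      let ?\<tau> = "\<lambda>\<omega>. if \<omega> \<in> ?A then \<tau> \<omega> else T"
      have \<tau>_from: "\<tau> \<in> pred_times_from M F T S"
        using sub[OF S] \<tau> by blast
      then have \<tau>_pred: "\<tau> \<in> pred_times M F T"
        by (simp add: pred_times_from_def)
      have \<tau>A_pred: "?\<tau> \<in> pred_times M F T"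
        by (rule pred_times_restrict[OF S A(1) \<tau>_from])
      have \<tau>A: "?\<tau> \<in> \<K> S'"
        by (rule paste[OF S S' \<tau> \<tau>A_pred])
      have "AE \<omega> in M. \<tau> \<omega> = ?\<tau> \<omega> \<longrightarrow> \<phi> \<tau> \<omega> = \<phi> ?\<tau> \<omega>"
        by (rule \<phi>[unfolded admissible_def, THEN conjunct2, THEN bspec[OF _ \<tau>_pred], THEN bspec[OF _ \<tau>A_pred]])
      then have eq: "AE \<omega> in M. \<omega> \<in> ?A \<longrightarrow> \<phi> \<tau> \<omega> = \<phi> ?\<tau> \<omega>"
        by eventually_elim simp
      have trace: "B \<inter> ?A \<in> sets (?G S')" if "B \<in> sets (?G S)" for B
        by (rule strict_past_trace[OF A(2) that])
      have trace': "B \<inter> ?A \<in> sets (?G S)" if "B \<in> sets (?G S')" for B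
        using strict_past_trace[of S' S B] A(1) that by (simp add: eq_commute)
      have "AE \<omega> in M. \<omega> \<in> ?A \<longrightarrow> X \<omega> = nn_cond_exp M (?G S') (\<phi> ?\<tau>) \<omega>"
        unfolding X
        by (rule nn_cond_exp_local[OF G[OF S] G[OF S'] A(2) trace trace' \<phi>M[OF \<tau>_pred] \<phi>M[OF \<tau>A_pred] eq])
      then have "AE \<omega> in M. \<omega> \<in> ?A \<longrightarrow> X \<omega> \<le> nn_cond_exp M (?G S') (\<phi> ?\<tau>) \<omega>"
        by eventually_elim simp
      with \<tau>A show "\<exists>X'\<in>?\<X> S'. AE \<omega> in M. \<omega> \<in> ?A \<longrightarrow> X \<omega> \<le> X' \<omega>"
        by blast
    qed
    then show ?thesis
      using AE_space by eventually_elim simp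
  qed
  have "?V S \<in> borel_measurable (?G S)" if "S \<in> pred_times M F T" for S
    by (rule borel_measurable_ess_sup_family[OF G[OF that] null_in_strict_past]) auto
  moreover have "AE \<omega> in M. S \<omega> = S' \<omega> \<longrightarrow> ?V S \<omega> = ?V S' \<omega>"
    if "S \<in> pred_times M F T" "S' \<in> pred_times M F T" for S S'
    using le[OF that] le[OF that(2,1)] by eventually_elim (simp add: antisym)
  ultimately show ?thesis
    unfolding admissible_def by blast
qed

lemma admissible_value_family:
  assumes "admissible M F T \<phi>"
  shows "admissible M F T (value_family M F T \<phi>)"
proof -
  have "admissible M F T (\<lambda>S. ess_sup_family M
      ((\<lambda>\<tau>. nn_cond_exp M (strict_past M F T S) (\<phi> \<tau>)) ` pred_times_from M F T S))"
  proof (rule admissible_ess_sup_cond_exp[OF assms order_refl])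
    fix S S' \<tau> :: "'a \<Rightarrow> real"
    let ?\<tau> = "\<lambda>\<omega>. if \<omega> \<in> {\<omega> \<in> space M. S \<omega> = S' \<omega>} then \<tau> \<omega> else T"
    assume S': "S' \<in> pred_times M F T" and \<tau>: "\<tau> \<in> pred_times_from M F T S"
      and \<tau>A: "?\<tau> \<in> pred_times M F T"
    have "AE \<omega> in M. S \<omega> \<le> \<tau> \<omega>"
      using \<tau> by (simp add: pred_times_from_def)
    then have "AE \<omega> in M. S' \<omega> \<le> ?\<tau> \<omega>"
      using AE_space by eventually_elim (use S' in \<open>auto simp: pred_times_def\<close>)
    with \<tau>A show "?\<tau> \<in> pred_times_from M F T S'"
      by (simp add: pred_times_from_def)
  qed
  then show ?thesis
    by (simp add: value_family_def[abs_def])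
qed

lemma admissible_strict_value_family:
  assumes "admissible M F T \<phi>"
  shows "admissible M F T (strict_value_family M F T \<phi>)"
proof -
  have "admissible M F T (\<lambda>S. ess_sup_family M
      ((\<lambda>\<tau>. nn_cond_exp M (strict_past M F T S) (\<phi> \<tau>)) ` pred_times_after M F T S))"
  proof (rule admissible_ess_sup_cond_exp[OF assms])
    fix S :: "'a \<Rightarrow> real" assume S: "S \<in> pred_times M F T"
    show "pred_times_after M F T S \<subseteq> pred_times_from M F T S"
    proof
      fix \<tau> assume \<tau>: "\<tau> \<in> pred_times_after M F T S"
      then have "AE \<omega> in M. S \<omega> < T \<longrightarrow> S \<omega> < \<tau> \<omega>" "AE \<omega> in M. S \<omega> = T \<longrightarrow> \<tau> \<omega> = T"
        by (simp_all add: pred_times_after_def)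
      then have "AE \<omega> in M. S \<omega> \<le> \<tau> \<omega>"
        using AE_space by eventually_elim (use S in \<open>force simp: pred_times_def\<close>)
      with \<tau> show "\<tau> \<in> pred_times_from M F T S"
        by (simp add: pred_times_after_def pred_times_from_def)
    qed
  next
    fix S S' \<tau> :: "'a \<Rightarrow> real"
    let ?\<tau> = "\<lambda>\<omega>. if \<omega> \<in> {\<omega> \<in> space M. S \<omega> = S' \<omega>} then \<tau> \<omega> else T"
    assume \<tau>: "\<tau> \<in> pred_times_after M F T S" and \<tau>A: "?\<tau> \<in> pred_times M F T"
    have "AE \<omega> in M. S \<omega> < T \<longrightarrow> S \<omega> < \<tau> \<omega>" "AE \<omega> in M. S \<omega> = T \<longrightarrow> \<tau> \<omega> = T"
      using \<tau> by (simp_all add: pred_times_after_def)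
    then have "AE \<omega> in M. S' \<omega> < T \<longrightarrow> S' \<omega> < ?\<tau> \<omega>" "AE \<omega> in M. S' \<omega> = T \<longrightarrow> ?\<tau> \<omega> = T"
      by (eventually_elim; auto)+
    with \<tau>A show "?\<tau> \<in> pred_times_after M F T S'"
      by (simp add: pred_times_after_def)
  qed
  then show ?thesis
    by (simp add: strict_value_family_def[abs_def])
qed

end

theorem mainTheorem3:
  fixes M :: "'a measure" and F :: "real \<Rightarrow> 'a measure" and T :: real
    and \<phi> :: "('a \<Rightarrow> real) \<Rightarrow> 'a \<Rightarrow> ennreal"
  assumes "usual_filtered_prob_space M F T"
    and "admissible M F T \<phi>"
  shows "admissible M F T (value_family M F T \<phi>) \<and> admissible M F T (strict_value_family M F T \<phi>)"
proof -
  interpret usual_filtered_prob_space M F T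
    by (rule assms(1))
  show ?thesis
    using assms(2) admissible_value_family admissible_strict_value_family by blast
qed

end
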